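(* Let $0<\beta<1$ be a real number. Then the Daroczy entropy $$H_\beta(p_1,\dots,p_n)=\frac{1}{1-2^{1-\beta}}\Big(1-\sum_{i=1}^n p_i^\beta\Big),\qquad (p_1,\dots,p_n)\in\Omega_n,\ n\ge1,$$ is a lower entropy function.
   Context: For each integer $N\ge 1$ let $\Omega_N=\{(p_1,\dots,p_N): p_i\ge 0,\ \sum_{i=1}^N p_i=1\}$, and let $\Omega=\bigcup_{N\ge1}\Omega_N$. A function $H:\Omega\to\mathbb{R}$ is called a lower entropy function if it satisfies: (i) Continuity: the restriction of $H$ to each $\Omega_N$ is continuous, and $H(p_1,\dots,p_N)=0$ if and only if there is $k$ with $p_k=1$. (ii) Symmetric expansibility: $H(p_1,\dots,p_N)$ is invariant under permutations of its arguments, and $H(p_1,\dots,p_{n-1},p_n,\dots,p_N)=H(p_1,\dots,p_{n-1},0,p_n,\dots,p_N)$ for all $(p_1,\dots,p_N)\in\Omega_N$ and $1\le n\le N$. (iii) Increasing property: if $(p_1,\dots,p_N)\in\Omega_N$, $1\le n\le N$, $m\ge1$, $q_1,\dots,q_m\ge 0$ and $p_n=\sum_{i=1}^m q_i$, then $$H(p_1,\dots,p_{n-1},q_1,\dots,q_m,p_{n+1},\dots,p_N)-H(p_1,\dots,p_N)\ge p_n H\Big(\frac{q_1}{p_n},\dots,\frac{q_m}{p_n}\Big),$$ where the right-hand side is read as $0$ when $p_n=0$. (iv) Maximum: for every $N\ge1$ and $(p_1,\dots,p_N)\in\Omega_N$, $H(p_1,\dots,p_N)\le H(\frac1N,\dots,\frac1N)$.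 *)

theory Defs
  imports "HOL-Analysis.Analysis" "HOL-Combinatorics.Combinatorics"
begin

text \<open>Finite probability vectors \<open>(p\<^sub>1, \<dots>, p\<^sub>N)\<close> are lists, so list positions start at 0.\<close>

definition Omega_n :: "nat \<Rightarrow> real list set" where
  "Omega_n N = {ps. length ps = N \<and> (\<forall>p\<in>set ps. 0 \<le> p) \<and> sum_list ps = 1}"

definition Omega :: "real list set" where
  "Omega = (\<Union>N\<in>{1..}. Omega_n N)"

text \<open>Lists carry no topology in the library. Continuity on \<open>Omega_n N\<close> is continuity on the
  corresponding subspace of \<open>Euclidean_space N\<close>, whose points are the sequences vanishing from
  index \<open>N\<close> on.\<close>

definition entropy_continuity :: "(real list \<Rightarrow> real) \<Rightarrow> bool" where
  "entropy_continuity H \<longleftrightarrow>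
     (\<forall>N\<ge>1. continuous_map
        (subtopology (Euclidean_space N) {x. map x [0..<N] \<in> Omega_n N})
        euclideanreal
        (\<lambda>x. H (map x [0..<N]))) \<and>
     (\<forall>ps\<in>Omega. H ps = 0 \<longleftrightarrow> (\<exists>k<length ps. ps ! k = 1))"

definition entropy_symmetric_expansibility :: "(real list \<Rightarrow> real) \<Rightarrow> bool" where
  "entropy_symmetric_expansibility H \<longleftrightarrow>
     (\<forall>ps\<in>Omega. \<forall>\<pi>. \<pi> permutes {..<length ps} \<longrightarrow> H (permute_list \<pi> ps) = H ps) \<and>
     (\<forall>xs p ys. xs @ p # ys \<in> Omega \<longrightarrow> H (xs @ p # ys) = H (xs @ 0 # p # ys))"

definition entropy_increasing :: "(real list \<Rightarrow> real) \<Rightarrow> bool" where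
  "entropy_increasing H \<longleftrightarrow>
     (\<forall>xs p ys qs. xs @ p # ys \<in> Omega \<and> qs \<noteq> [] \<and> (\<forall>q\<in>set qs. 0 \<le> q) \<and> p = sum_list qs \<longrightarrow>
        H (xs @ qs @ ys) - H (xs @ p # ys) \<ge>
          (if p = 0 then 0 else p * H (map (\<lambda>q. q / p) qs)))"

definition entropy_maximum :: "(real list \<Rightarrow> real) \<Rightarrow> bool" where
  "entropy_maximum H \<longleftrightarrow>
     (\<forall>N\<ge>1. \<forall>ps\<in>Omega_n N. H ps \<le> H (replicate N (1 / real N)))"

definition lower_entropy_function :: "(real list \<Rightarrow> real) \<Rightarrow> bool" where
  "lower_entropy_function H \<longleftrightarrow>
     entropy_continuity H \<and> entropy_symmetric_expansibility H \<and>
     entropy_increasing H \<and> entropy_maximum H"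

text \<open>In the library \<open>0 powr \<beta> = 0\<close>, which is the usual convention for \<open>\<beta> > 0\<close>.\<close>

definition daroczy_entropy :: "real \<Rightarrow> real list \<Rightarrow> real" where
  "daroczy_entropy \<beta> ps = 1 / (1 - 2 powr (1 - \<beta>)) * (1 - (\<Sum>p\<leftarrow>ps. p powr \<beta>))"

end

theory Submission
  imports Defs
begin

text \<open>Write \<open>c = 1 / (2 powr (1 - \<beta>) - 1) > 0\<close> and \<open>S ps\<close> for the sum of the powers
  \<open>p powr \<beta>\<close>, so that the Daroczy entropy is \<open>c * (S ps - 1)\<close> with a positive factor. Every axiom
  then becomes a statement about \<open>S\<close>. This sum is symmetric, ignores zero entries, and is continuous even
  where entries vanish because \<open>\<beta> > 0\<close>.

  On \<open>[0, 1]\<close> the function \<open>p powr \<beta>\<close> lies above the identity and meets it only at \<open>0\<close> and \<open>1\<close>.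
  Hence \<open>S ps \<ge> 1\<close> on probability vectors, with equality exactly at the degenerate ones.

  For the increasing property, put \<open>p = sum_list qs\<close>. The left-hand side is \<open>c * D\<close> with
  \<open>D = S qs - p powr \<beta>\<close>, and homogeneity of the power turns the right-hand side into
  \<open>p powr (1 - \<beta>) * (c * D)\<close>. Since \<open>p \<le> 1\<close>, the inequality comes down to \<open>D \<ge> 0\<close>, which is
  \<open>S \<ge> 1\<close> for the probability vector \<open>qs / p\<close>, scaled back.

  The maximum property is concavity of the power function: Young's inequality with second argument
  \<open>1 / N\<close> is the tangent-line bound at the uniform distribution, and summing it over the entries
  gives \<open>S ps \<le> N powr (1 - \<beta>)\<close>.\<close>

section \<open>Powers with exponent between zero and one\<close>

lemma le_powr_self:
  fixes x \<beta> :: real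
  assumes "0 < \<beta>" "\<beta> < 1" "0 \<le> x" "x \<le> 1"
  shows "x \<le> x powr \<beta>"
  using powr_mono'[of \<beta> 1 x] assms by simp

lemma powr_self_eq_iff:
  fixes x \<beta> :: real
  assumes "0 < \<beta>" "\<beta> < 1" "0 \<le> x" "x \<le> 1"
  shows "x powr \<beta> = x \<longleftrightarrow> x = 0 \<or> x = 1"
proof -
  have "x < x powr \<beta>" if "x \<noteq> 0" "x \<noteq> 1"
    using powr_less_mono'[of x \<beta> 1] assms that by simp
  then show ?thesis using assms by fastforce
qed

definition power_sum :: "real \<Rightarrow> real list \<Rightarrow> real" where
  "power_sum \<beta> ps = (\<Sum>p\<leftarrow>ps. p powr \<beta>)"

lemma power_sum_simps [simp]:
  "power_sum \<beta> [] = 0"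
  "power_sum \<beta> (p # ps) = p powr \<beta> + power_sum \<beta> ps"
  "power_sum \<beta> (xs @ ys) = power_sum \<beta> xs + power_sum \<beta> ys"
  by (simp_all add: power_sum_def)

lemma power_sum_nonneg: "0 \<le> power_sum \<beta> ps"
  by (induction ps) auto

lemma sum_list_le_power_sum:
  assumes "0 < \<beta>" "\<beta> < 1" "\<And>p. p \<in> set ps \<Longrightarrow> 0 \<le> p" "\<And>p. p \<in> set ps \<Longrightarrow> p \<le> 1"
  shows "sum_list ps \<le> power_sum \<beta> ps"
  using assms(3,4) by (induction ps) (auto intro!: add_mono le_powr_self[OF assms(1,2)])

lemma power_sum_eq_sum_list_iff:
  assumes "0 < \<beta>" "\<beta> < 1" "\<And>p. p \<in> set ps \<Longrightarrow> 0 \<le> p" "\<And>p. p \<in> set ps \<Longrightarrow> p \<le> 1"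
  shows "power_sum \<beta> ps = sum_list ps \<longleftrightarrow> (\<forall>p\<in>set ps. p = 0 \<or> p = 1)"
  using assms(3,4)
proof (induction ps)
  case (Cons p ps)
  have p: "p \<le> p powr \<beta>" "p powr \<beta> = p \<longleftrightarrow> p = 0 \<or> p = 1"
    using Cons.prems le_powr_self[OF assms(1,2)] powr_self_eq_iff[OF assms(1,2)] by simp_all
  have "sum_list ps \<le> power_sum \<beta> ps"
    using Cons.prems by (intro sum_list_le_power_sum[OF assms(1,2)]) auto
  moreover have "power_sum \<beta> ps = sum_list ps \<longleftrightarrow> (\<forall>q\<in>set ps. q = 0 \<or> q = 1)"
    using Cons by auto
  moreover have "power_sum \<beta> (p # ps) = sum_list (p # ps) \<longleftrightarrow>
      p powr \<beta> = p \<and> power_sum \<beta> ps = sum_list ps"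
    using p(1) calculation(1) by auto
  ultimately show ?case using p(2) by auto
qed simp

lemma power_sum_divide:
  assumes "0 < s" "\<And>q. q \<in> set qs \<Longrightarrow> 0 \<le> q"
  shows "power_sum \<beta> (map (\<lambda>q. q / s) qs) = power_sum \<beta> qs / s powr \<beta>"
  using assms(2) by (induction qs) (use assms(1) in \<open>auto simp: powr_divide add_divide_distrib\<close>)

lemma sum_list_divide: "sum_list (map (\<lambda>q. q / s) qs) = sum_list qs / (s::real)"
  by (induction qs) (auto simp: add_divide_distrib)

lemma le_sum_list:
  fixes ps :: "real list"
  assumes "\<And>p. p \<in> set ps \<Longrightarrow> 0 \<le> p" "p \<in> set ps"
  shows "p \<le> sum_list ps"
  using assms
proof (induction ps)
  case (Cons a ps)
  have "0 \<le> sum_list ps" using Cons.prems by (auto intro: sum_list_nonneg)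
  moreover have "0 \<le> a" using Cons.prems by simp
  moreover have "p \<le> sum_list ps" if "p \<in> set ps" using Cons that by simp
  ultimately show ?case using Cons.prems(2) by force
qed simp

text \<open>Dividing by the sum makes every entry at most \<open>1\<close>, so subadditivity of the power reduces to
  the pointwise bound by the identity.\<close>

lemma sum_list_powr_le_power_sum:
  assumes "0 < \<beta>" "\<beta> < 1" "\<And>q. q \<in> set qs \<Longrightarrow> 0 \<le> q"
  shows "sum_list qs powr \<beta> \<le> power_sum \<beta> qs"
proof (cases "sum_list qs = 0")
  case True
  then show ?thesis by (simp add: power_sum_nonneg)
next
  case False
  have s: "0 < sum_list qs" using False sum_list_nonneg[of qs] assms(3) by force
  have "1 = sum_list (map (\<lambda>q. q / sum_list qs) qs)"
    using s by (simp add: sum_list_divide)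
  also have "\<dots> \<le> power_sum \<beta> (map (\<lambda>q. q / sum_list qs) qs)"
    using s assms(3) le_sum_list[of qs] by (intro sum_list_le_power_sum[OF assms(1,2)]) auto
  also have "\<dots> = power_sum \<beta> qs / sum_list qs powr \<beta>"
    using s assms(3) by (rule power_sum_divide)
  finally show ?thesis using s by (simp add: field_simps)
qed

text \<open>Young's inequality for \<open>p\<close> and \<open>1 / N\<close> with weights \<open>\<beta>\<close> and \<open>1 - \<beta>\<close> bounds the power by
  its tangent at \<open>1 / N\<close>. For entries with sum \<open>1\<close> the linear terms add up to a constant.\<close>

lemma power_sum_le:
  assumes "0 < \<beta>" "\<beta> < 1" "\<And>p. p \<in> set ps \<Longrightarrow> 0 \<le> p" "sum_list ps = 1"
  shows "power_sum \<beta> ps \<le> real (length ps) powr (1 - \<beta>)"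
proof -
  define n where "n = real (length ps)"
  have n: "0 < n" using assms(4) by (cases ps) (auto simp: n_def)
  have young: "p powr \<beta> * (1 / n) powr (1 - \<beta>) \<le> \<beta> * p + (1 - \<beta>) * (1 / n)" if "0 \<le> p" for p
    using Youngs_inequality_0[of \<beta> "1 - \<beta>" p "1 / n"] assms(1,2) that n
    by (cases "p = 0") auto
  have "power_sum \<beta> qs * (1 / n) powr (1 - \<beta>)
      \<le> \<beta> * sum_list qs + (1 - \<beta>) * (real (length qs) / n)"
    if "\<And>q. q \<in> set qs \<Longrightarrow> 0 \<le> q" for qs
    using that
  proof (induction qs)
    case (Cons q qs)
    then show ?case using young[of q] by (auto simp: algebra_simps add_divide_distrib)
  qed simp
  from this[of ps] have "power_sum \<beta> ps * (1 / n) powr (1 - \<beta>) \<le> 1"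
    using assms(3,4) n by (simp add: n_def)
  then show ?thesis using n by (simp add: powr_divide field_simps flip: n_def)
qed

section \<open>The entropy axioms\<close>

context
  fixes \<beta> :: real
  assumes \<beta>: "0 < \<beta>" "\<beta> < 1"
begin

lemma daroczy_factor_pos: "0 < 1 / (2 powr (1 - \<beta>) - 1)"
  using \<beta> by simp

text \<open>Flipping the sign of the factor exhibits the entropy as a positive multiple of the excess of
  the power sum over \<open>1\<close>.\<close>

lemma daroczy_entropy_power_sum:
  "daroczy_entropy \<beta> ps = 1 / (2 powr (1 - \<beta>) - 1) * (power_sum \<beta> ps - 1)"
  proof -
  have "1 / (1 - a) * (1 - s) = 1 / (a - 1) * (s - 1)" for a s :: real
    using minus_divide_divide[of "1 - s" "1 - a"] by (simp only: minus_diff_eq times_divide_eq_left mult_1_left)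
  then show ?thesis by (simp only: daroczy_entropy_def power_sum_def)
qed

lemma OmegaD:
  assumes "ps \<in> Omega"
  shows "\<And>p. p \<in> set ps \<Longrightarrow> 0 \<le> p" "\<And>p. p \<in> set ps \<Longrightarrow> p \<le> 1" "sum_list ps = 1"
  using assms le_sum_list[of ps] by (auto simp: Omega_def Omega_n_def)

lemma daroczy_entropy_eq_0_iff:
  assumes "ps \<in> Omega"
  shows "daroczy_entropy \<beta> ps = 0 \<longleftrightarrow> (\<exists>k<length ps. ps ! k = 1)"
proof -
  note ps = OmegaD[OF assms]
  have "daroczy_entropy \<beta> ps = 0 \<longleftrightarrow> power_sum \<beta> ps = sum_list ps"
    unfolding daroczy_entropy_power_sum mult_eq_0_iff ps(3)
    using daroczy_factor_pos by (metis eq_iff_diff_eq_0 less_irrefl)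
  also have "\<dots> \<longleftrightarrow> (\<forall>p\<in>set ps. p = 0 \<or> p = 1)"
    using ps by (intro power_sum_eq_sum_list_iff[OF \<beta>])
  also have "\<dots> \<longleftrightarrow> 1 \<in> set ps"
  proof
    assume *: "\<forall>p\<in>set ps. p = 0 \<or> p = 1"
    show "1 \<in> set ps"
    proof (rule ccontr)
      assume "1 \<notin> set ps"
      then have "sum_list ps = 0" using * by (metis sum_list_nonneg_eq_0_iff order_refl)
      then show False using ps(3) by simp
    qed
  next
    assume "1 \<in> set ps"
    then obtain xs ys where eq: "ps = xs @ 1 # ys" by (meson split_list)
    have "sum_list (xs @ ys) = 0" using ps(3) eq by simp
    then have "\<forall>p\<in>set (xs @ ys). p = 0"
      using ps(1) eq by (subst (asm) sum_list_nonneg_eq_0_iff) auto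
    then show "\<forall>p\<in>set ps. p = 0 \<or> p = 1" using eq by auto
  qed
  finally show ?thesis by (simp add: in_set_conv_nth)
qed

lemma continuous_map_daroczy_entropy:
  "continuous_map (subtopology (Euclidean_space N) {x. map x [0..<N] \<in> Omega_n N})
     euclideanreal (\<lambda>x. daroczy_entropy \<beta> (map x [0..<N]))"
proof -
  let ?X = "subtopology (Euclidean_space N) {x. map x [0..<N] \<in> Omega_n N}"
  have "continuous_map ?X euclideanreal (\<lambda>x. x i powr \<beta>)" if i: "i < N" for i
  proof -
    have "continuous_map ?X euclideanreal (\<lambda>x. x i)"
      unfolding Euclidean_space_def
      by (intro continuous_map_from_subtopology continuous_map_product_projection) simp
    moreover have "x i \<ge> 0" if "x \<in> topspace ?X" for x
      using that i by (auto simp: Omega_n_def)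
    ultimately have "continuous_map ?X (top_of_set {0..}) (\<lambda>x. x i)"
      by (auto simp: continuous_map_in_subtopology)
    moreover have "continuous_on {0..} (\<lambda>t::real. t powr \<beta>)"
      by (rule continuous_on_powr'[OF continuous_on_id continuous_on_const]) (use \<beta> in auto)
    then have "continuous_map (top_of_set {0..}) euclideanreal (\<lambda>t::real. t powr \<beta>)"
      by simp
    ultimately show ?thesis
      by (rule continuous_map_compose[unfolded o_def])
  qed
  then have "continuous_map ?X euclideanreal (\<lambda>x. \<Sum>i<N. x i powr \<beta>)"
    by (intro continuous_map_sum) auto
  moreover have "power_sum \<beta> (map x [0..<N]) = (\<Sum>i<N. x i powr \<beta>)" for x :: "nat \<Rightarrow> real"
    by (simp add: power_sum_def o_def interv_sum_list_conv_sum_set_nat atLeast0LessThan)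
  ultimately show ?thesis
    unfolding daroczy_entropy_power_sum
    by (intro continuous_map_real_mult continuous_map_diff) simp_all
qed

lemma daroczy_entropy_permute_list:
  assumes "\<pi> permutes {..<length ps}"
  shows "daroczy_entropy \<beta> (permute_list \<pi> ps) = daroczy_entropy \<beta> ps"
proof -
  have "mset (map (\<lambda>p. p powr \<beta>) (permute_list \<pi> ps)) = mset (map (\<lambda>p. p powr \<beta>) ps)"
    using assms by simp
  then show ?thesis
    unfolding daroczy_entropy_def by (metis sum_mset_sum_list)
qed

lemma daroczy_entropy_increasing:
  assumes Om: "xs @ p # ys \<in> Omega" and qs: "\<And>q. q \<in> set qs \<Longrightarrow> 0 \<le> q" and p: "p = sum_list qs"
  shows "(if p = 0 then 0 else p * daroczy_entropy \<beta> (map (\<lambda>q. q / p) qs))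
    \<le> daroczy_entropy \<beta> (xs @ qs @ ys) - daroczy_entropy \<beta> (xs @ p # ys)"
proof -
  define c where "c = 1 / (2 powr (1 - \<beta>) - 1)"
  define D where "D = power_sum \<beta> qs - p powr \<beta>"
  have c: "0 < c" using daroczy_factor_pos by (simp add: c_def)
  have D: "0 \<le> D" using sum_list_powr_le_power_sum[OF \<beta> qs] by (simp add: D_def p)
  have diff: "daroczy_entropy \<beta> (xs @ qs @ ys) - daroczy_entropy \<beta> (xs @ p # ys) = c * D"
    by (simp add: daroczy_entropy_power_sum D_def algebra_simps flip: c_def)
  have p01: "0 \<le> p" "p \<le> 1" using OmegaD[OF Om] by auto
  show ?thesis
  proof (cases "p = 0")
    case True
    have "0 \<le> c * D" using c D by simp
    then show ?thesis unfolding diff using True by simp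
  next
    case False
    then have "0 < p" using p01 by simp
    have "p * daroczy_entropy \<beta> (map (\<lambda>q. q / p) qs) = p * (c * (D / p powr \<beta>))"
      using \<open>0 < p\<close> qs
      by (simp add: daroczy_entropy_power_sum power_sum_divide D_def diff_divide_distrib flip: c_def)
    also have "\<dots> = p powr (1 - \<beta>) * (c * D)"
      using \<open>0 < p\<close> by (simp add: powr_diff)
    also have "\<dots> \<le> 1 * (c * D)"
      using p01 \<beta> c D by (intro mult_right_mono powr_le1) auto
    finally show ?thesis using False by (simp add: diff)
  qed
qed

lemma daroczy_entropy_le_uniform:
  assumes "ps \<in> Omega_n N"
  shows "daroczy_entropy \<beta> ps \<le> daroczy_entropy \<beta> (replicate N (1 / real N))"
proof -
  have ps: "length ps = N" "\<And>p. p \<in> set ps \<Longrightarrow> 0 \<le> p" "sum_list ps = 1"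
    using assms by (auto simp: Omega_n_def)
  then have "0 < N" by auto
  then have "power_sum \<beta> (replicate N (1 / real N)) = real N powr (1 - \<beta>)"
    by (simp add: power_sum_def map_replicate sum_list_replicate powr_divide powr_diff)
  then have "power_sum \<beta> ps \<le> power_sum \<beta> (replicate N (1 / real N))"
    using power_sum_le[OF \<beta>, of ps] ps by simp
  then show ?thesis
    unfolding daroczy_entropy_power_sum
    using daroczy_factor_pos by (intro mult_left_mono) auto
qed

end

theorem mainTheorem8:
  fixes \<beta> :: real
  assumes "0 < \<beta>" and "\<beta> < 1"
  shows "lower_entropy_function (daroczy_entropy \<beta>)"
proof -
  note * = assms
  have "entropy_continuity (daroczy_entropy \<beta>)"
    using continuous_map_daroczy_entropy[OF *] daroczy_entropy_eq_0_iff[OF *]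
    by (simp add: entropy_continuity_def)
  moreover have "entropy_symmetric_expansibility (daroczy_entropy \<beta>)"
    using daroczy_entropy_permute_list[OF *]
    by (simp add: entropy_symmetric_expansibility_def daroczy_entropy_def)
  moreover have "entropy_increasing (daroczy_entropy \<beta>)"
    unfolding entropy_increasing_def using daroczy_entropy_increasing[OF *] by blast
  moreover have "entropy_maximum (daroczy_entropy \<beta>)"
    using daroczy_entropy_le_uniform[OF *] by (simp add: entropy_maximum_def)
  ultimately show ?thesis by (simp add: lower_entropy_function_def)
qed

end
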